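(* Let $G$ be a finite group acting on a finite nonempty set $X$, and let $Q$ be the dual Burnside kernel on $G^*$. For $g\in G^*$ let $[g]$ denote its conjugacy class in $G$ (which is contained in $G^*$). The kernel $Q$ is strongly lumpable by conjugacy classes in $G^*$. Its lumped kernel is $$\bar Q([g],[h])=\frac1{|X_g|}\sum_{x\in X_g}\frac{|G_x\cap[h]|}{|G_x|}.$$ The lumped stationary law is $$\bar\pi_Q([g])=\frac{|[g]|\,|X_g|}{|G|\,|X/G|}.$$ Moreover, $\bar Q$ is reversible (with respect to $\bar\pi_Q$) and irreducible. For all integers $t\ge0$ and all $g\in G^*$, $$d_Q(g,t)\ge d_{\bar Q}([g],t).$$ If $Q(g,\cdot)$ is class-constant, i.e. $Q(g,aha^{-1})=Q(g,h)$ for all $a\in G$, $h\in G^*$, then equality holds for all $t\ge1$. This holds in particular when $g$ lies in the center $Z(G)$.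
   Context: For $g\in G$ and $x\in X$ write $X_g:=\{x\in X: g\cdot x=x\}$, $G_x:=\{g\in G: g\cdot x=x\}$, and $G^*:=\{g\in G: X_g\neq\varnothing\}$. The dual Burnside kernel on $G^*$ is $$Q(g,h)=\frac1{|X_g|}\sum_{x\in X_g\cap X_h}\frac1{|G_x|},$$ with stationary law $\pi_Q(g)=|X_g|/(|G|\,|X/G|)$. A kernel $P$ on a finite set $S$ is strongly lumpable with respect to a partition $\{B_i\}$ of $S$ if for all $i,j$ the sum $\sum_{y\in B_j}P(x,y)$ is the same for all $x\in B_i$; the lumped kernel is then $\bar P(B_i,B_j):=\sum_{y\in B_j}P(x,y)$ ($x\in B_i$), and the lumped stationary law is $\bar\pi(B_i)=\sum_{x\in B_i}\pi(x)$, which is stationary for $\bar P$. For a kernel $P$ with stationary law $\pi$, $d_P(s,t):=\|P^t(s,\cdot)-\pi\|_{\mathrm{TV}}$ with $\|\mu-\nu\|_{\mathrm{TV}}=\frac12\sum_s|\mu(s)-\nu(s)|$; $d_{\bar Q}$ is taken relative to $\bar\pi_Q$. *)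

theory Defs
  imports "HOL-Algebra.Group_Action" "HOL-Library.Disjoint_Sets" Complex_Main
begin

section \<open>Markov kernels on a finite set\<close>

text \<open>
  A kernel on a finite set \<open>S\<close> is a function \<open>P :: 's \<Rightarrow> 's \<Rightarrow> real\<close> of which only
  the values on \<open>S \<times> S\<close> matter; a law on \<open>S\<close> is treated in the same way.
\<close>

definition markov_kernel :: "'s set \<Rightarrow> ('s \<Rightarrow> 's \<Rightarrow> real) \<Rightarrow> bool" where
  "markov_kernel S P \<longleftrightarrow>
     (\<forall>x\<in>S. \<forall>y\<in>S. 0 \<le> P x y) \<and> (\<forall>x\<in>S. (\<Sum>y\<in>S. P x y) = 1)"

definition stationary_law :: "'s set \<Rightarrow> ('s \<Rightarrow> 's \<Rightarrow> real) \<Rightarrow> ('s \<Rightarrow> real) \<Rightarrow> bool" where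
  "stationary_law S P \<pi> \<longleftrightarrow>
     (\<forall>x\<in>S. 0 \<le> \<pi> x) \<and> (\<Sum>x\<in>S. \<pi> x) = 1 \<and> (\<forall>y\<in>S. (\<Sum>x\<in>S. \<pi> x * P x y) = \<pi> y)"

primrec kernel_pow :: "'s set \<Rightarrow> ('s \<Rightarrow> 's \<Rightarrow> real) \<Rightarrow> nat \<Rightarrow> 's \<Rightarrow> 's \<Rightarrow> real" where
  "kernel_pow S P 0 = (\<lambda>x y. if x = y then 1 else 0)"
| "kernel_pow S P (Suc t) = (\<lambda>x y. \<Sum>z\<in>S. kernel_pow S P t x z * P z y)"

definition reversible_kernel :: "'s set \<Rightarrow> ('s \<Rightarrow> 's \<Rightarrow> real) \<Rightarrow> ('s \<Rightarrow> real) \<Rightarrow> bool" where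
  "reversible_kernel S P \<pi> \<longleftrightarrow> (\<forall>x\<in>S. \<forall>y\<in>S. \<pi> x * P x y = \<pi> y * P y x)"

definition irreducible_kernel :: "'s set \<Rightarrow> ('s \<Rightarrow> 's \<Rightarrow> real) \<Rightarrow> bool" where
  "irreducible_kernel S P \<longleftrightarrow> (\<forall>x\<in>S. \<forall>y\<in>S. \<exists>t>0. kernel_pow S P t x y > 0)"

definition tv_dist :: "'s set \<Rightarrow> ('s \<Rightarrow> real) \<Rightarrow> ('s \<Rightarrow> real) \<Rightarrow> real" where
  "tv_dist S \<mu> \<nu> = (1/2) * (\<Sum>s\<in>S. \<bar>\<mu> s - \<nu> s\<bar>)"

definition mixing_dist ::
    "'s set \<Rightarrow> ('s \<Rightarrow> 's \<Rightarrow> real) \<Rightarrow> ('s \<Rightarrow> real) \<Rightarrow> 's \<Rightarrow> nat \<Rightarrow> real" where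
  "mixing_dist S P \<pi> s t = tv_dist S (kernel_pow S P t s) \<pi>"

definition strongly_lumpable :: "'s set \<Rightarrow> ('s \<Rightarrow> 's \<Rightarrow> real) \<Rightarrow> 's set set \<Rightarrow> bool" where
  "strongly_lumpable S P \<B> \<longleftrightarrow>
     finite S \<and> markov_kernel S P \<and> partition_on S \<B> \<and>
     (\<forall>A\<in>\<B>. \<forall>B\<in>\<B>. \<forall>x\<in>A. \<forall>x'\<in>A. (\<Sum>y\<in>B. P x y) = (\<Sum>y\<in>B. P x' y))"

text \<open>The blocks themselves are the states of the lumped kernel; its entry at \<open>(A, B)\<close>
  is the common value of the block sums, and is only meaningful if \<open>P\<close> is strongly lumpable.\<close>

definition lumped_kernel :: "('s \<Rightarrow> 's \<Rightarrow> real) \<Rightarrow> 's set \<Rightarrow> 's set \<Rightarrow> real" where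
  "lumped_kernel P A B = (THE r. \<forall>x\<in>A. (\<Sum>y\<in>B. P x y) = r)"

definition lumped_law :: "('s \<Rightarrow> real) \<Rightarrow> 's set \<Rightarrow> real" where
  "lumped_law \<pi> A = (\<Sum>x\<in>A. \<pi> x)"


section \<open>The dual Burnside kernel\<close>

definition conj_class :: "('a, 'm) monoid_scheme \<Rightarrow> 'a \<Rightarrow> 'a set" where
  "conj_class G g = {a \<otimes>\<^bsub>G\<^esub> g \<otimes>\<^bsub>G\<^esub> inv\<^bsub>G\<^esub> a | a. a \<in> carrier G}"

definition group_center :: "('a, 'm) monoid_scheme \<Rightarrow> 'a set" where
  "group_center G = {z \<in> carrier G. \<forall>a\<in>carrier G. z \<otimes>\<^bsub>G\<^esub> a = a \<otimes>\<^bsub>G\<^esub> z}"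

text \<open>For an action \<open>\<phi>\<close> of \<open>G\<close> on \<open>X\<close>, the fixed-point set \<open>X\<^sub>g\<close> is \<^term>\<open>invariants X \<phi> g\<close>,
  \<open>G\<^sub>x\<close> is \<^term>\<open>stabilizer G \<phi> x\<close>, and \<open>X/G\<close> is \<^term>\<open>orbits G X \<phi>\<close>.\<close>

definition fixing_elements :: "('a, 'm) monoid_scheme \<Rightarrow> 'x set \<Rightarrow> ('a \<Rightarrow> 'x \<Rightarrow> 'x) \<Rightarrow> 'a set" where
  "fixing_elements G X \<phi> = {g \<in> carrier G. invariants X \<phi> g \<noteq> {}}"

definition dual_burnside ::
    "('a, 'm) monoid_scheme \<Rightarrow> 'x set \<Rightarrow> ('a \<Rightarrow> 'x \<Rightarrow> 'x) \<Rightarrow> 'a \<Rightarrow> 'a \<Rightarrow> real" where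
  "dual_burnside G X \<phi> g h =
     1 / real (card (invariants X \<phi> g)) *
     (\<Sum>x\<in>invariants X \<phi> g \<inter> invariants X \<phi> h. 1 / real (card (stabilizer G \<phi> x)))"

definition dual_burnside_law ::
    "('a, 'm) monoid_scheme \<Rightarrow> 'x set \<Rightarrow> ('a \<Rightarrow> 'x \<Rightarrow> 'x) \<Rightarrow> 'a \<Rightarrow> real" where
  "dual_burnside_law G X \<phi> g =
     real (card (invariants X \<phi> g)) / (real (order G) * real (card (orbits G X \<phi>)))"

definition fixing_classes ::
    "('a, 'm) monoid_scheme \<Rightarrow> 'x set \<Rightarrow> ('a \<Rightarrow> 'x \<Rightarrow> 'x) \<Rightarrow> 'a set set" where
  "fixing_classes G X \<phi> = conj_class G ` fixing_elements G X \<phi>"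

end

(*
  Conjugation is a symmetry of the dual Burnside kernel: Q(a g a^-1, a h a^-1) = Q(g, h), because
  X_{a g a^-1} = a X_g and |G_{a x}| = |G_x|. Hence block sums over conjugacy classes do not depend
  on the representative, the powers of Q descend to the quotient, and reversibility and positivity
  are inherited. The total variation inequality is the triangle inequality on each class; it is an
  equality when both laws are constant on the classes, and by the symmetry this property of
  Q^t(g, -) propagates from t to t + 1.
*)
theory Submission
  imports Defs
begin

section \<open>Lumping of finite kernels\<close>

lemma sum_partition_on:
  fixes f :: "'s \<Rightarrow> 'b::comm_monoid_add"
  assumes "finite S" "partition_on S \<B>"
  shows "(\<Sum>B\<in>\<B>. \<Sum>y\<in>B. f y) = (\<Sum>y\<in>S. f y)"
proof -
  have S: "S = \<Union>\<B>" and disj: "disjoint \<B>"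
    using assms(2) by (auto simp: partition_on_def)
  have "\<forall>B\<in>\<B>. finite B"
    using assms(1) unfolding S by (meson Sup_upper finite_subset)
  moreover have "\<forall>A\<in>\<B>. \<forall>B\<in>\<B>. A \<noteq> B \<longrightarrow> A \<inter> B = {}"
    using disj by (auto simp: disjoint_def)
  ultimately have "sum f (\<Union>\<B>) = (sum \<circ> sum) f \<B>"
    by (rule sum.Union_disjoint)
  thus ?thesis by (simp add: S)
qed

lemma strongly_lumpable_partition:
  assumes "strongly_lumpable S P \<B>"
  shows "finite S" "partition_on S \<B>" "finite \<B>"
  using assms finite_elements unfolding strongly_lumpable_def by blast+

lemma strongly_lumpable_block_subset:
  assumes "strongly_lumpable S P \<B>" "A \<in> \<B>"
  shows "A \<subseteq> S" "finite A" "A \<noteq> {}"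
proof -
  note p = strongly_lumpable_partition[OF assms(1)]
  show "A \<subseteq> S" using p(2) assms(2) by (auto simp: partition_on_def)
  thus "finite A" using p(1) by (rule finite_subset)
  show "A \<noteq> {}" using p(2) assms(2) by (auto simp: partition_on_def)
qed

text \<open>Strong lumpability provides the value and the member \<open>x\<close> of
  \<open>A\<close> makes it unique, so the definite description is met. Every later computation with
  the lumped kernel passes through a representative by this rule.\<close>

lemma lumped_kernel_eq:
  assumes "strongly_lumpable S P \<B>" "A \<in> \<B>" "B \<in> \<B>" "x \<in> A"
  shows "lumped_kernel P A B = (\<Sum>y\<in>B. P x y)"
  unfolding lumped_kernel_def
proof (rule the_equality)
  show "\<forall>x'\<in>A. (\<Sum>y\<in>B. P x' y) = (\<Sum>y\<in>B. P x y)"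
    using assms unfolding strongly_lumpable_def by blast
  show "r = (\<Sum>y\<in>B. P x y)" if "\<forall>x\<in>A. (\<Sum>y\<in>B. P x y) = r" for r
    using that assms(4) by metis
qed

lemma markov_lumped_kernel:
  assumes L: "strongly_lumpable S P \<B>"
  shows "markov_kernel \<B> (lumped_kernel P)"
  unfolding markov_kernel_def
proof (intro conjI ballI)
  have M: "markov_kernel S P" using L by (simp add: strongly_lumpable_def)
  note p = strongly_lumpable_partition[OF L]
  fix A assume A: "A \<in> \<B>"
  then obtain x where x: "x \<in> A" "x \<in> S"
    using strongly_lumpable_block_subset[OF L] by blast
  have "(\<Sum>B\<in>\<B>. lumped_kernel P A B) = (\<Sum>B\<in>\<B>. \<Sum>y\<in>B. P x y)"
    using lumped_kernel_eq[OF L A _ x(1)] by simp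
  also have "\<dots> = (\<Sum>y\<in>S. P x y)"
    by (rule sum_partition_on[OF p(1,2)])
  finally show "(\<Sum>B\<in>\<B>. lumped_kernel P A B) = 1"
    using M x by (simp add: markov_kernel_def)
  fix B assume B: "B \<in> \<B>"
  have "0 \<le> (\<Sum>y\<in>B. P x y)"
    using M x strongly_lumpable_block_subset(1)[OF L B]
    by (intro sum_nonneg) (auto simp: markov_kernel_def)
  thus "0 \<le> lumped_kernel P A B"
    using lumped_kernel_eq[OF L A B x(1)] by simp
qed

section \<open>Powers, irreducibility and reversibility under lumping\<close>

lemma kernel_pow_nonneg:
  assumes "markov_kernel S P" "x \<in> S" "y \<in> S"
  shows "0 \<le> kernel_pow S P t x y"
  using assms(3)
proof (induction t arbitrary: y)
  case (Suc t)
  thus ?case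
    using assms(1) by (auto intro!: sum_nonneg mult_nonneg_nonneg simp: markov_kernel_def)
qed simp

text \<open>Lumping commutes with taking powers: the last step into \<open>B\<close> has the same
  probability from every state of an intermediate block \<open>D\<close>, so the sum over blocks
  unfolds into a sum over all of \<open>S\<close>.\<close>

lemma kernel_pow_lumped_kernel:
  assumes L: "strongly_lumpable S P \<B>" and A: "A \<in> \<B>" and x: "x \<in> A" and B: "B \<in> \<B>"
  shows "kernel_pow \<B> (lumped_kernel P) t A B = (\<Sum>y\<in>B. kernel_pow S P t x y)"
  using B
proof (induction t arbitrary: B)
  case 0
  note p = strongly_lumpable_partition[OF L]
  have "finite B" using strongly_lumpable_block_subset[OF L 0] by simp
  \<comment> \<open>Blocks are disjoint, so the point mass at \<open>x\<close> gives
    \<open>B\<close> mass one exactly when \<open>B\<close> is the block of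
    \<open>x\<close>.\<close>
  moreover have "x \<in> B \<longleftrightarrow> A = B"
    using p(2) A 0 x by (auto simp: partition_on_def disjoint_def)
  ultimately show ?case by (simp add: sum.delta)
next
  case (Suc t)
  note p = strongly_lumpable_partition[OF L]
  have "kernel_pow \<B> (lumped_kernel P) (Suc t) A B
      = (\<Sum>D\<in>\<B>. (\<Sum>z\<in>D. kernel_pow S P t x z) * lumped_kernel P D B)"
    using Suc.IH by simp
  also have "\<dots> = (\<Sum>D\<in>\<B>. \<Sum>z\<in>D. kernel_pow S P t x z * (\<Sum>y\<in>B. P z y))"
    using lumped_kernel_eq[OF L _ Suc.prems] by (auto simp: sum_distrib_right intro!: sum.cong)
  also have "\<dots> = (\<Sum>z\<in>S. kernel_pow S P t x z * (\<Sum>y\<in>B. P z y))"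
    by (rule sum_partition_on[OF p(1,2)])
  also have "\<dots> = (\<Sum>y\<in>B. kernel_pow S P (Suc t) x y)"
    by (simp add: sum_distrib_left sum.swap[of _ S B])
  finally show ?case .
qed

text \<open>A positive entry between two representatives is one summand of a nonnegative block sum,
  and that sum is an entry of the same power of the lumped kernel.\<close>

lemma irreducible_lumped_kernel:
  assumes L: "strongly_lumpable S P \<B>" and "irreducible_kernel S P"
  shows "irreducible_kernel \<B> (lumped_kernel P)"
  unfolding irreducible_kernel_def
proof (intro ballI)
  fix A B assume A: "A \<in> \<B>" and B: "B \<in> \<B>"
  have M: "markov_kernel S P" using L by (simp add: strongly_lumpable_def)
  obtain x y where xy: "x \<in> A" "y \<in> B" "x \<in> S" "y \<in> S"
    using strongly_lumpable_block_subset[OF L A] strongly_lumpable_block_subset[OF L B] by blast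
  then obtain t where t: "t > 0" "kernel_pow S P t x y > 0"
    using assms(2) unfolding irreducible_kernel_def by blast
  have "0 < (\<Sum>y\<in>B. kernel_pow S P t x y)"
    using strongly_lumpable_block_subset[OF L B] kernel_pow_nonneg[OF M xy(3)] t(2) xy(2)
    by (intro sum_pos2[of B y]) auto
  thus "\<exists>t>0. 0 < kernel_pow \<B> (lumped_kernel P) t A B"
    using kernel_pow_lumped_kernel[OF L A xy(1) B] t(1) by auto
qed

text \<open>Each side is the total flow from one block to the other, so detailed balance for the
  blocks is pointwise detailed balance summed over pairs of states.\<close>

lemma reversible_lumped_kernel:
  assumes L: "strongly_lumpable S P \<B>" and R: "reversible_kernel S P \<pi>"
  shows "reversible_kernel \<B> (lumped_kernel P) (lumped_law \<pi>)"
  unfolding reversible_kernel_def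
proof (intro ballI)
  fix A B assume A: "A \<in> \<B>" and B: "B \<in> \<B>"
  have flow: "lumped_law \<pi> D * lumped_kernel P D E = (\<Sum>x\<in>D. \<Sum>y\<in>E. \<pi> x * P x y)"
    if "D \<in> \<B>" "E \<in> \<B>" for D E
    using lumped_kernel_eq[OF L that]
    by (simp add: lumped_law_def sum_distrib_right sum_distrib_left)
  have "\<pi> x * P x y = \<pi> y * P y x" if "x \<in> A" "y \<in> B" for x y
    using R that strongly_lumpable_block_subset(1)[OF L A] strongly_lumpable_block_subset(1)[OF L B]
    unfolding reversible_kernel_def by blast
  hence "(\<Sum>x\<in>A. \<Sum>y\<in>B. \<pi> x * P x y) = (\<Sum>x\<in>A. \<Sum>y\<in>B. \<pi> y * P y x)"
    by (intro sum.cong) auto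
  also have "\<dots> = (\<Sum>y\<in>B. \<Sum>x\<in>A. \<pi> y * P y x)"
    by (rule sum.swap)
  finally show "lumped_law \<pi> A * lumped_kernel P A B = lumped_law \<pi> B * lumped_kernel P B A"
    using flow A B by simp
qed

lemma reversible_imp_stationary:
  assumes "markov_kernel S P" "reversible_kernel S P \<pi>" "\<forall>x\<in>S. 0 \<le> \<pi> x" "(\<Sum>x\<in>S. \<pi> x) = 1"
  shows "stationary_law S P \<pi>"
  unfolding stationary_law_def
proof (intro conjI ballI assms(4))
  fix y assume y: "y \<in> S"
  have "(\<Sum>x\<in>S. \<pi> x * P x y) = (\<Sum>x\<in>S. \<pi> y * P y x)"
    using assms(2) y by (intro sum.cong) (auto simp: reversible_kernel_def)
  also have "\<dots> = \<pi> y"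
    using assms(1) y by (simp add: markov_kernel_def flip: sum_distrib_left)
  finally show "(\<Sum>x\<in>S. \<pi> x * P x y) = \<pi> y" .
qed (use assms(3) in blast)

section \<open>Total variation distance under lumping\<close>

lemma mixing_dist_lumped_kernel:
  assumes L: "strongly_lumpable S P \<B>" and A: "A \<in> \<B>" and x: "x \<in> A"
  shows "mixing_dist \<B> (lumped_kernel P) (lumped_law \<pi>) A t
    = 1/2 * (\<Sum>B\<in>\<B>. \<bar>\<Sum>y\<in>B. kernel_pow S P t x y - \<pi> y\<bar>)"
  using kernel_pow_lumped_kernel[OF L A x]
  by (simp add: mixing_dist_def tv_dist_def lumped_law_def sum_subtractf)

text \<open>Written this way, the distance differs from that of the lumped chain only in having the
  absolute value inside the block sum instead of outside.\<close>

lemma mixing_dist_blocks: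
  assumes L: "strongly_lumpable S P \<B>"
  shows "mixing_dist S P \<pi> x t = 1/2 * (\<Sum>B\<in>\<B>. \<Sum>y\<in>B. \<bar>kernel_pow S P t x y - \<pi> y\<bar>)"
  using sum_partition_on[OF strongly_lumpable_partition(1,2)[OF L],
      where f = "\<lambda>y. \<bar>kernel_pow S P t x y - \<pi> y\<bar>"]
  by (simp add: mixing_dist_def tv_dist_def)

lemma mixing_dist_lumped_le:
  assumes "strongly_lumpable S P \<B>" "A \<in> \<B>" "x \<in> A"
  shows "mixing_dist \<B> (lumped_kernel P) (lumped_law \<pi>) A t \<le> mixing_dist S P \<pi> x t"
  unfolding mixing_dist_lumped_kernel[OF assms] mixing_dist_blocks[OF assms(1)]
  by (intro mult_left_mono sum_mono sum_abs) auto

lemma mixing_dist_lumped_eq: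
  assumes "strongly_lumpable S P \<B>" "A \<in> \<B>" "x \<in> A"
    and const: "\<And>B y z. B \<in> \<B> \<Longrightarrow> y \<in> B \<Longrightarrow> z \<in> B \<Longrightarrow>
      kernel_pow S P t x y = kernel_pow S P t x z \<and> \<pi> y = \<pi> z"
  shows "mixing_dist S P \<pi> x t = mixing_dist \<B> (lumped_kernel P) (lumped_law \<pi>) A t"
proof -
  have "(\<Sum>y\<in>B. \<bar>kernel_pow S P t x y - \<pi> y\<bar>) = \<bar>\<Sum>y\<in>B. kernel_pow S P t x y - \<pi> y\<bar>"
    if B: "B \<in> \<B>" for B
  proof -
    obtain z where z: "z \<in> B" using strongly_lumpable_block_subset(3)[OF assms(1) B] by blast
    \<comment> \<open>The difference of the two laws is constantly \<open>c\<close> on the block, so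
      there is no cancellation and both sides are the size of the block times
      \<open>\<bar>c\<bar>\<close>.\<close>
    define c where "c = kernel_pow S P t x z - \<pi> z"
    have "kernel_pow S P t x y - \<pi> y = c" if "y \<in> B" for y
      using const[OF B that z] by (simp add: c_def)
    thus ?thesis by (simp add: abs_mult)
  qed
  thus ?thesis
    unfolding mixing_dist_lumped_kernel[OF assms(1-3)] mixing_dist_blocks[OF assms(1)] by simp
qed

text \<open>Only the row at \<open>x\<close> has to be invariant in its second argument alone;
  elsewhere \<open>f\<close> acts on both arguments. The induction starts at the first power because
  the point mass at \<open>x\<close> is not invariant when \<open>f\<close> moves \<open>x\<close>.
  This is the source of the restriction to positive times.\<close>

lemma kernel_pow_Suc_symmetric:
  assumes f: "bij_betw f S S"
    and P: "\<And>z y. z \<in> S \<Longrightarrow> y \<in> S \<Longrightarrow> P (f z) (f y) = P z y"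
    and x: "\<And>y. y \<in> S \<Longrightarrow> P x (f y) = P x y"
    and S: "finite S" "x \<in> S" and y: "y \<in> S"
  shows "kernel_pow S P (Suc t) x (f y) = kernel_pow S P (Suc t) x y"
  using y
proof (induction t arbitrary: y)
  case 0
  have "(\<Sum>z\<in>S. (if x = z then 1 else 0) * P z w) = P x w" for w
  proof -
    have "(\<Sum>z\<in>S. (if x = z then 1 else 0) * P z w) = (\<Sum>z\<in>S. if x = z then P z w else 0)"
      by (intro sum.cong) auto
    thus ?thesis using S by simp
  qed
  thus ?case using x 0 by simp
next
  case (Suc t)
  \<comment> \<open>Replacing the intermediate state \<open>z\<close> by \<open>f z\<close> lets the
    induction hypothesis remove \<open>f\<close> from the first factor and the symmetry of
    \<open>P\<close> remove it from the second.\<close>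
  have "kernel_pow S P (Suc (Suc t)) x (f y)
      = (\<Sum>z\<in>S. kernel_pow S P (Suc t) x (f z) * P (f z) (f y))"
    unfolding kernel_pow.simps(2)[of S P "Suc t"]
    by (rule sum.reindex_bij_betw[OF f, symmetric])
  also have "\<dots> = (\<Sum>z\<in>S. kernel_pow S P (Suc t) x z * P z y)"
    using Suc.IH P Suc.prems by (intro sum.cong) (auto simp del: kernel_pow.simps)
  finally show ?case by (simp only: kernel_pow.simps(2)[of S P "Suc t"])
qed

section \<open>Conjugation invariance of the dual Burnside kernel\<close>

lemma (in group) conj_class_self:
  assumes "g \<in> carrier G"
  shows "g \<in> conj_class G g"
proof -
  have "g = \<one> \<otimes> g \<otimes> inv \<one>" using assms by simp
  thus ?thesis unfolding conj_class_def by blast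
qed

text \<open>Conjugacy is an equivalence relation: conjugators multiply for transitivity and invert
  for symmetry. Closure under conjugation keeps the classes inside \<open>S\<close>.\<close>

lemma (in group) conj_class_partition:
  assumes S: "S \<subseteq> carrier G"
    and closed: "\<And>a g. a \<in> carrier G \<Longrightarrow> g \<in> S \<Longrightarrow> a \<otimes> g \<otimes> inv a \<in> S"
  shows "partition_on S (conj_class G ` S)"
proof -
  have mem: "g \<in> conj_class G g" if "g \<in> S" for g
    using that S conj_class_self by blast
  have trans: "conj_class G h \<subseteq> conj_class G g" if "g \<in> S" and h: "h \<in> conj_class G g" for g h
  proof
    fix k assume "k \<in> conj_class G h"
    then obtain b where b: "b \<in> carrier G" "k = b \<otimes> h \<otimes> inv b"
      unfolding conj_class_def by blast
    obtain a where a: "a \<in> carrier G" "h = a \<otimes> g \<otimes> inv a"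
      using h unfolding conj_class_def by blast
    have "g \<in> carrier G" using that S by blast
    hence "k = (b \<otimes> a) \<otimes> g \<otimes> inv (b \<otimes> a)" using a b by (simp add: inv_mult_group m_assoc)
    thus "k \<in> conj_class G g" using a(1) b(1) unfolding conj_class_def by blast
  qed
  have sym: "g \<in> conj_class G h" if "g \<in> S" and h: "h \<in> conj_class G g" for g h
  proof -
    obtain a where a: "a \<in> carrier G" "h = a \<otimes> g \<otimes> inv a"
      using h unfolding conj_class_def by blast
    have "g \<in> carrier G" using that S by blast
    hence "g = inv a \<otimes> h \<otimes> inv (inv a)"
      \<comment> \<open>Grouping to the left cancels the leading pair
        \<open>inv a \<otimes> a\<close>; grouping to the right cancels the trailing one.\<close>
      using a by (simp add: m_assoc[symmetric]) (simp add: m_assoc)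
    thus ?thesis using a unfolding conj_class_def by blast
  qed
  have sub: "conj_class G g \<subseteq> S" if "g \<in> S" for g
    using closed that unfolding conj_class_def by blast
  have eq: "conj_class G g = conj_class G h" if "g \<in> S" "h \<in> S" "k \<in> conj_class G g" "k \<in> conj_class G h" for g h k
    using trans sym that sub by blast
  show ?thesis
    unfolding partition_on_def disjoint_def using mem sub eq by blast
qed

section \<open>Fixed points and stabilizers under conjugation\<close>

locale finite_group_action = group_action G E \<phi> for G (structure) and E and \<phi> +
  assumes finite_group: "finite (carrier G)" and finite_space: "finite E"

sublocale finite_group_action \<subseteq> group G
  using group_hom group_hom.axioms(1) by blast

context finite_group_action
begin

lemma finite_invariants: "finite (invariants E \<phi> g)"
  using finite_space by (simp add: invariants_def)

lemma finite_stabilizer: "finite (stabilizer G \<phi> x)"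
  using finite_group stabilizer_subset by (rule finite_subset[rotated])

lemma card_stabilizer_pos: "x \<in> E \<Longrightarrow> card (stabilizer G \<phi> x) > 0"
  using stabilizer_one_closed finite_stabilizer by (auto simp: card_gt_0_iff)

lemma fixing_elements_subset: "fixing_elements G E \<phi> \<subseteq> carrier G"
  by (auto simp: fixing_elements_def)

lemma finite_fixing_elements: "finite (fixing_elements G E \<phi>)"
  using finite_group fixing_elements_subset by (rule finite_subset[rotated])

lemma card_invariants_pos: "g \<in> fixing_elements G E \<phi> \<Longrightarrow> card (invariants E \<phi> g) > 0"
  using finite_invariants by (auto simp: card_gt_0_iff fixing_elements_def)

text \<open>Whatever fixes \<open>x\<close> has a fixed point, namely \<open>x\<close>. Hence the
  rows of the kernel already have their full mass on the fixing elements.\<close>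

lemma stabilizer_subset_fixing_elements: "x \<in> E \<Longrightarrow> stabilizer G \<phi> x \<subseteq> fixing_elements G E \<phi>"
  by (auto simp: stabilizer_def fixing_elements_def invariants_def)

lemma invariants_conj_subset:
  assumes "a \<in> carrier G" "g \<in> carrier G"
  shows "\<phi> a ` invariants E \<phi> g \<subseteq> invariants E \<phi> (a \<otimes> g \<otimes> inv a)"
proof
  fix y assume "y \<in> \<phi> a ` invariants E \<phi> g"
  then obtain x where x: "x \<in> E" "\<phi> g x = x" "y = \<phi> a x" by (auto simp: invariants_def)
  have "y \<in> E" using x assms element_image by blast
  \<comment> \<open>The conjugate moves \<open>y\<close> back to \<open>x\<close>, fixes it by
    \<open>g\<close>, and returns it to \<open>y\<close> by \<open>a\<close>.\<close>
  moreover have "\<phi> (inv a) y = x" using orbit_sym_aux[OF assms(1) x(1)] x(3) by simp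
  ultimately show "y \<in> invariants E \<phi> (a \<otimes> g \<otimes> inv a)"
    using x assms by (simp add: invariants_def composition_rule)
qed

lemma invariants_conj:
  assumes "a \<in> carrier G" "g \<in> carrier G"
  shows "invariants E \<phi> (a \<otimes> g \<otimes> inv a) = \<phi> a ` invariants E \<phi> g"
proof
  show "invariants E \<phi> (a \<otimes> g \<otimes> inv a) \<subseteq> \<phi> a ` invariants E \<phi> g"
  proof
    fix y assume y: "y \<in> invariants E \<phi> (a \<otimes> g \<otimes> inv a)"
    hence yE: "y \<in> E" by (simp add: invariants_def)
    \<comment> \<open>The reverse inclusion is the inclusion already proved, applied to
      \<open>inv a\<close> and the conjugate of \<open>g\<close>.\<close>
    have "inv a \<otimes> (a \<otimes> g \<otimes> inv a) \<otimes> inv (inv a) = g"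
      using assms by (simp add: m_assoc[symmetric]) (simp add: m_assoc)
    hence "\<phi> (inv a) y \<in> invariants E \<phi> g"
      using invariants_conj_subset[of "inv a" "a \<otimes> g \<otimes> inv a"] y assms by auto
    moreover have "y = \<phi> a (\<phi> (inv a) y)"
      using orbit_sym_aux[of "inv a" y] assms(1) yE by simp
    ultimately show "y \<in> \<phi> a ` invariants E \<phi> g" by blast
  qed
qed (rule invariants_conj_subset[OF assms])

lemma card_invariants_conj:
  assumes "a \<in> carrier G" "g \<in> carrier G"
  shows "card (invariants E \<phi> (a \<otimes> g \<otimes> inv a)) = card (invariants E \<phi> g)"
  unfolding invariants_conj[OF assms]
  by (intro card_image inj_on_subset[OF inj_prop[OF assms(1)]]) (auto simp: invariants_def)

text \<open>The points \<open>x\<close> and \<open>\<phi> a x\<close> share an orbit, so the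
  orbit-stabilizer theorem gives two factorizations of the group order with the same positive orbit
  size, which cancels.\<close>

lemma card_stabilizer_image:
  assumes "a \<in> carrier G" "x \<in> E"
  shows "card (stabilizer G \<phi> (\<phi> a x)) = card (stabilizer G \<phi> x)"
proof -
  let ?y = "\<phi> a x"
  have y: "?y \<in> E" "?y \<in> orbit G \<phi> x"
    using assms element_image by (auto simp: orbit_def)
  hence "orbit G \<phi> x = orbit G \<phi> ?y"
    using disjoint_union[of "orbit G \<phi> x" "orbit G \<phi> ?y"] orbit_refl assms
    unfolding orbits_def by blast
  moreover have "card (orbit G \<phi> x) > 0"
    using orbit_refl[OF assms(2)] finite_group by (auto simp: card_gt_0_iff orbit_def)
  moreover have "card (orbit G \<phi> x) * card (stabilizer G \<phi> x) = card (orbit G \<phi> ?y) * card (stabilizer G \<phi> ?y)"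
    using orbit_stabilizer_theorem y assms by simp
  ultimately show ?thesis by simp
qed

lemma fixing_elements_conj:
  assumes "a \<in> carrier G" "g \<in> fixing_elements G E \<phi>"
  shows "a \<otimes> g \<otimes> inv a \<in> fixing_elements G E \<phi>"
proof -
  have "g \<in> carrier G" using assms by (simp add: fixing_elements_def)
  thus ?thesis using assms invariants_conj[OF assms(1)] by (simp add: fixing_elements_def)
qed

lemma bij_betw_conj_fixing_elements:
  assumes "a \<in> carrier G"
  shows "bij_betw (\<lambda>g. a \<otimes> g \<otimes> inv a) (fixing_elements G E \<phi>) (fixing_elements G E \<phi>)"
proof -
  have inj: "inj_on (\<lambda>g. a \<otimes> g \<otimes> inv a) (fixing_elements G E \<phi>)"
    using conjugation_is_inj[OF assms] fixing_elements_subset by (auto intro!: inj_onI)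
  moreover have "(\<lambda>g. a \<otimes> g \<otimes> inv a) ` fixing_elements G E \<phi> \<subseteq> fixing_elements G E \<phi>"
    using fixing_elements_conj[OF assms] by blast
  ultimately show ?thesis
    using endo_inj_surj[OF finite_fixing_elements] by (simp add: bij_betw_def)
qed

section \<open>Symmetry, block sums, lumpability and irreducibility of the dual Burnside
  kernel\<close>

lemma dual_burnside_conj:
  assumes a: "a \<in> carrier G" and g: "g \<in> carrier G" and h: "h \<in> carrier G"
  shows "dual_burnside G E \<phi> (a \<otimes> g \<otimes> inv a) (a \<otimes> h \<otimes> inv a) = dual_burnside G E \<phi> g h"
proof -
  have sub: "invariants E \<phi> k \<subseteq> E" for k by (auto simp: invariants_def)
  let ?I = "invariants E \<phi> g \<inter> invariants E \<phi> h"
  \<comment> \<open>The image of the intersection is the intersection of the images because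
    \<open>\<phi> a\<close> is injective on \<open>E\<close>.\<close>
  have "invariants E \<phi> (a \<otimes> g \<otimes> inv a) \<inter> invariants E \<phi> (a \<otimes> h \<otimes> inv a) = \<phi> a ` ?I"
    unfolding invariants_conj[OF a g] invariants_conj[OF a h]
    using inj_on_image_Int[OF inj_prop[OF a] sub sub] by simp
  moreover have "inj_on (\<phi> a) ?I"
    using inj_prop[OF a] sub by (meson inj_on_subset inf.coboundedI1)
  moreover have "card (stabilizer G \<phi> (\<phi> a x)) = card (stabilizer G \<phi> x)" if "x \<in> ?I" for x
    using card_stabilizer_image[OF a] that sub by blast
  ultimately show ?thesis
    by (simp add: dual_burnside_def card_invariants_conj[OF a g] sum.reindex)
qed

text \<open>Double counting of pairs of a point and an element of \<open>B\<close> fixing it. The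
  whole set of fixing elements as \<open>B\<close> yields the row sums, and a conjugacy class yields
  the lumped kernel.\<close>

lemma sum_dual_burnside:
  assumes "B \<subseteq> carrier G"
  shows "(\<Sum>h\<in>B. dual_burnside G E \<phi> g h) = 1 / real (card (invariants E \<phi> g)) *
    (\<Sum>x\<in>invariants E \<phi> g. real (card (stabilizer G \<phi> x \<inter> B)) / real (card (stabilizer G \<phi> x)))"
proof -
  have B: "finite B" using assms finite_group by (rule finite_subset)
  let ?w = "\<lambda>x. 1 / real (card (stabilizer G \<phi> x))"
  have "(\<Sum>h\<in>B. \<Sum>x\<in>invariants E \<phi> g \<inter> invariants E \<phi> h. ?w x)
      = (\<Sum>h\<in>B. \<Sum>x\<in>invariants E \<phi> g. if x \<in> invariants E \<phi> h then ?w x else 0)"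
    using finite_invariants by (simp add: sum.inter_restrict)
  also have "\<dots> = (\<Sum>x\<in>invariants E \<phi> g. \<Sum>h\<in>B. if x \<in> invariants E \<phi> h then ?w x else 0)"
    by (rule sum.swap)
  \<comment> \<open>For fixed \<open>x\<close>, the condition on \<open>h\<close> is read as
    membership in the stabilizer, so the inner sum counts elements.\<close>
  also have "\<dots> = (\<Sum>x\<in>invariants E \<phi> g. \<Sum>h\<in>B. if h \<in> stabilizer G \<phi> x then ?w x else 0)"
    using assms by (intro sum.cong) (auto simp: invariants_def stabilizer_def)
  also have "\<dots> = (\<Sum>x\<in>invariants E \<phi> g. \<Sum>h\<in>B \<inter> stabilizer G \<phi> x. ?w x)"
    by (simp only: sum.inter_restrict[OF B])
  also have "\<dots> = (\<Sum>x\<in>invariants E \<phi> g.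
      real (card (stabilizer G \<phi> x \<inter> B)) / real (card (stabilizer G \<phi> x)))"
    by (simp add: Int_commute)
  finally show ?thesis by (simp only: dual_burnside_def flip: sum_distrib_left)
qed

lemma dual_burnside_nonneg: "0 \<le> dual_burnside G E \<phi> g h"
  by (simp add: dual_burnside_def sum_nonneg)

lemma markov_dual_burnside: "markov_kernel (fixing_elements G E \<phi>) (dual_burnside G E \<phi>)"
  unfolding markov_kernel_def
proof (intro conjI ballI dual_burnside_nonneg)
  fix g assume g: "g \<in> fixing_elements G E \<phi>"
  have "real (card (stabilizer G \<phi> x \<inter> fixing_elements G E \<phi>)) / real (card (stabilizer G \<phi> x)) = 1"
    if "x \<in> invariants E \<phi> g" for x
  proof -
    have "x \<in> E" using that by (simp add: invariants_def)
    thus ?thesis using stabilizer_subset_fixing_elements card_stabilizer_pos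
      by (simp add: Int_absorb2)
  qed
  hence "(\<Sum>h\<in>fixing_elements G E \<phi>. dual_burnside G E \<phi> g h)
      = 1 / real (card (invariants E \<phi> g)) * (\<Sum>x\<in>invariants E \<phi> g. 1)"
    unfolding sum_dual_burnside[OF fixing_elements_subset] by (simp only: cong: sum.cong)
  thus "(\<Sum>h\<in>fixing_elements G E \<phi>. dual_burnside G E \<phi> g h) = 1"
    using card_invariants_pos[OF g] by simp
qed

lemma strongly_lumpable_dual_burnside:
  "strongly_lumpable (fixing_elements G E \<phi>) (dual_burnside G E \<phi>) (fixing_classes G E \<phi>)"
  unfolding strongly_lumpable_def
proof (intro conjI ballI finite_fixing_elements markov_dual_burnside)
  show part: "partition_on (fixing_elements G E \<phi>) (fixing_classes G E \<phi>)"
    unfolding fixing_classes_def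
    using fixing_elements_subset fixing_elements_conj by (rule conj_class_partition)
  fix A B x x'
  assume A: "A \<in> fixing_classes G E \<phi>" and B: "B \<in> fixing_classes G E \<phi>" and x: "x \<in> A" "x' \<in> A"
  have BS: "B \<subseteq> fixing_elements G E \<phi>" using part B by (auto simp: partition_on_def)
  \<comment> \<open>Conjugation by \<open>a\<close> permutes the class \<open>B\<close>. Reindexing
    by it puts conjugates in both arguments of the kernel, and the symmetry then removes
    them.\<close>
  have *: "(\<Sum>y\<in>B. dual_burnside G E \<phi> (a \<otimes> g \<otimes> inv a) y) = (\<Sum>y\<in>B. dual_burnside G E \<phi> g y)"
    if a: "a \<in> carrier G" and g: "g \<in> carrier G" for a g
  proof -
    have closed: "a \<otimes> y \<otimes> inv a \<in> B" if y: "y \<in> B" for y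
    proof -
      obtain h b where "h \<in> fixing_elements G E \<phi>" "B = conj_class G h" "b \<in> carrier G"
        "y = b \<otimes> h \<otimes> inv b"
        using y B unfolding fixing_classes_def conj_class_def by blast
      moreover from this have "a \<otimes> y \<otimes> inv a = (a \<otimes> b) \<otimes> h \<otimes> inv (a \<otimes> b)"
        using a fixing_elements_subset by (simp add: subset_iff inv_mult_group m_assoc)
      ultimately show ?thesis using a unfolding conj_class_def by blast
    qed
    have "inj_on (\<lambda>y. a \<otimes> y \<otimes> inv a) B"
      using bij_betw_conj_fixing_elements[OF a] BS by (meson bij_betw_def inj_on_subset)
    moreover have "finite B" using BS finite_fixing_elements by (rule finite_subset)
    ultimately have "bij_betw (\<lambda>y. a \<otimes> y \<otimes> inv a) B B"
      using endo_inj_surj[of B "\<lambda>y. a \<otimes> y \<otimes> inv a"] closed by (auto simp: bij_betw_def)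
    hence "(\<Sum>y\<in>B. dual_burnside G E \<phi> (a \<otimes> g \<otimes> inv a) y)
        = (\<Sum>y\<in>B. dual_burnside G E \<phi> (a \<otimes> g \<otimes> inv a) (a \<otimes> y \<otimes> inv a))"
      by (rule sum.reindex_bij_betw[symmetric])
    also have "\<dots> = (\<Sum>y\<in>B. dual_burnside G E \<phi> g y)"
      using dual_burnside_conj[OF a g] BS fixing_elements_subset by (intro sum.cong) auto
    finally show ?thesis .
  qed
  obtain g where g: "g \<in> fixing_elements G E \<phi>" "A = conj_class G g"
    using A by (auto simp: fixing_classes_def)
  have "(\<Sum>y\<in>B. dual_burnside G E \<phi> z y) = (\<Sum>y\<in>B. dual_burnside G E \<phi> g y)" if "z \<in> A" for z
    using that * g fixing_elements_subset by (auto simp: conj_class_def)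
  thus "(\<Sum>y\<in>B. dual_burnside G E \<phi> x y) = (\<Sum>y\<in>B. dual_burnside G E \<phi> x' y)"
    using x by simp
qed

text \<open>The number of fixed points in the law cancels the prefactor of the kernel, leaving an
  expression symmetric in the two group elements.\<close>

lemma reversible_dual_burnside:
  "reversible_kernel (fixing_elements G E \<phi>) (dual_burnside G E \<phi>) (dual_burnside_law G E \<phi>)"
  unfolding reversible_kernel_def
  using card_invariants_pos
  by (auto simp: dual_burnside_def dual_burnside_law_def Int_commute)

lemma one_in_fixing_elements: "E \<noteq> {} \<Longrightarrow> \<one> \<in> fixing_elements G E \<phi>"
  using stabilizer_one_closed stabilizer_subset_fixing_elements by blast

text \<open>The normalization is Burnside's orbit-counting lemma.\<close>

lemma sum_dual_burnside_law:
  assumes "E \<noteq> {}"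
  shows "(\<Sum>g\<in>fixing_elements G E \<phi>. dual_burnside_law G E \<phi> g) = 1"
proof -
  have "finite (orbits G E \<phi>)"
    using finite_space by (simp add: orbits_def)
  moreover have "orbits G E \<phi> \<noteq> {}" using assms by (auto simp: orbits_def)
  ultimately have pos: "card (orbits G E \<phi>) > 0" by (simp add: card_gt_0_iff)
  have ord: "order G > 0" using finite_group by (simp add: order_gt_0_iff_finite)
  \<comment> \<open>Group elements outside the index set on the left have no fixed points and
    contribute zero.\<close>
  have "(\<Sum>g\<in>fixing_elements G E \<phi>. card (invariants E \<phi> g)) = (\<Sum>g\<in>carrier G. card (invariants E \<phi> g))"
    using finite_group fixing_elements_subset
    by (intro sum.mono_neutral_left) (auto simp: fixing_elements_def)
  also have "\<dots> = card (orbits G E \<phi>) * order G"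
    using burnside[OF finite_group finite_space] by simp
  finally have "(\<Sum>g\<in>fixing_elements G E \<phi>. real (card (invariants E \<phi> g)))
      = real (card (orbits G E \<phi>)) * real (order G)"
    by (metis of_nat_sum of_nat_mult)
  thus ?thesis
    using pos ord by (simp add: dual_burnside_law_def flip: sum_divide_distrib)
qed

lemma dual_burnside_pos:
  assumes "x \<in> invariants E \<phi> g" "x \<in> invariants E \<phi> h"
  shows "0 < dual_burnside G E \<phi> g h"
proof -
  have "x \<in> E" using assms by (simp add: invariants_def)
  hence "0 < (\<Sum>x\<in>invariants E \<phi> g \<inter> invariants E \<phi> h. 1 / real (card (stabilizer G \<phi> x)))"
    using finite_invariants assms card_stabilizer_pos by (intro sum_pos2[of _ x]) auto
  moreover have "card (invariants E \<phi> g) > 0"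
    using assms(1) finite_invariants by (auto simp: card_gt_0_iff)
  ultimately show ?thesis by (simp add: dual_burnside_def)
qed

text \<open>The identity fixes every point, so any two states communicate through it in two steps.\<close>

lemma irreducible_dual_burnside:
  assumes "E \<noteq> {}"
  shows "irreducible_kernel (fixing_elements G E \<phi>) (dual_burnside G E \<phi>)"
  unfolding irreducible_kernel_def
proof (intro ballI)
  let ?S = "fixing_elements G E \<phi>" and ?Q = "dual_burnside G E \<phi>"
  fix g h assume g: "g \<in> ?S" and h: "h \<in> ?S"
  have one: "x \<in> invariants E \<phi> \<one>" if "x \<in> E" for x
    using stabilizer_one_closed[OF that] that by (simp add: stabilizer_def invariants_def)
  obtain x y where "x \<in> invariants E \<phi> g" "y \<in> invariants E \<phi> h"
    using g h by (auto simp: fixing_elements_def)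
  moreover from this have "x \<in> invariants E \<phi> \<one>" "y \<in> invariants E \<phi> \<one>"
    using one by (auto simp: invariants_def)
  ultimately have "?Q g \<one> > 0" "?Q \<one> h > 0"
    using dual_burnside_pos by blast+
  have step: "kernel_pow ?S ?Q (Suc 0) g z = ?Q g z" for z
  proof -
    have "kernel_pow ?S ?Q (Suc 0) g z = (\<Sum>w\<in>?S. if g = w then ?Q w z else 0)"
      by (auto intro!: sum.cong)
    thus ?thesis using g finite_fixing_elements by simp
  qed
  \<comment> \<open>The summand at \<open>\<one>\<close> is positive and all others are
    nonnegative.\<close>
  have "0 < (\<Sum>z\<in>?S. ?Q g z * ?Q z h)"
    using finite_fixing_elements one_in_fixing_elements[OF assms] dual_burnside_nonneg
      \<open>?Q g \<one> > 0\<close> \<open>?Q \<one> h > 0\<close>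
    by (intro sum_pos2[of _ \<one>]) auto
  hence "0 < kernel_pow ?S ?Q (Suc (Suc 0)) g h"
    unfolding kernel_pow.simps(2)[of ?S ?Q "Suc 0"] step .
  thus "\<exists>t>0. 0 < kernel_pow ?S ?Q t g h" by blast
qed

section \<open>The lumped chain on conjugacy classes\<close>

lemma dual_burnside_law_class:
  assumes "g \<in> fixing_elements G E \<phi>" "h \<in> conj_class G g"
  shows "dual_burnside_law G E \<phi> h = dual_burnside_law G E \<phi> g"
proof -
  have "g \<in> carrier G" using assms fixing_elements_subset by blast
  thus ?thesis
    using assms(2) card_invariants_conj by (auto simp: conj_class_def dual_burnside_law_def)
qed

lemma lumped_dual_burnside_law:
  assumes "g \<in> fixing_elements G E \<phi>"
  shows "lumped_law (dual_burnside_law G E \<phi>) (conj_class G g)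
    = real (card (conj_class G g)) * real (card (invariants E \<phi> g)) /
      (real (order G) * real (card (orbits G E \<phi>)))"
proof -
  have "lumped_law (dual_burnside_law G E \<phi>) (conj_class G g)
      = (\<Sum>h\<in>conj_class G g. dual_burnside_law G E \<phi> g)"
    unfolding lumped_law_def by (intro sum.cong refl dual_burnside_law_class assms)
  thus ?thesis by (simp add: dual_burnside_law_def)
qed

lemma conj_class_fixing:
  assumes "g \<in> fixing_elements G E \<phi>"
  shows "g \<in> conj_class G g" "conj_class G g \<in> fixing_classes G E \<phi>"
  using assms conj_class_self fixing_elements_subset by (auto simp: fixing_classes_def)

lemma lumped_dual_burnside:
  assumes g: "g \<in> fixing_elements G E \<phi>" and h: "h \<in> fixing_elements G E \<phi>"
  shows "lumped_kernel (dual_burnside G E \<phi>) (conj_class G g) (conj_class G h) =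
    1 / real (card (invariants E \<phi> g)) *
    (\<Sum>x\<in>invariants E \<phi> g.
      real (card (stabilizer G \<phi> x \<inter> conj_class G h)) / real (card (stabilizer G \<phi> x)))"
proof -
  note L = strongly_lumpable_dual_burnside
  have "conj_class G h \<subseteq> carrier G"
    using strongly_lumpable_block_subset(1)[OF L conj_class_fixing(2)[OF h]] fixing_elements_subset
    by blast
  thus ?thesis
    using lumped_kernel_eq[OF L conj_class_fixing(2)[OF g] conj_class_fixing(2)[OF h] conj_class_fixing(1)[OF g]]
      sum_dual_burnside by simp
qed

text \<open>Stationarity comes from detailed balance for the lumped chain; the total mass is that of
  the original law, regrouped by classes.\<close>

lemma stationary_lumped_dual_burnside:
  assumes "E \<noteq> {}"
  shows "stationary_law (fixing_classes G E \<phi>) (lumped_kernel (dual_burnside G E \<phi>))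
    (lumped_law (dual_burnside_law G E \<phi>))"
proof (rule reversible_imp_stationary)
  note L = strongly_lumpable_dual_burnside
  show "markov_kernel (fixing_classes G E \<phi>) (lumped_kernel (dual_burnside G E \<phi>))"
    by (rule markov_lumped_kernel[OF L])
  show "reversible_kernel (fixing_classes G E \<phi>) (lumped_kernel (dual_burnside G E \<phi>))
    (lumped_law (dual_burnside_law G E \<phi>))"
    by (rule reversible_lumped_kernel[OF L reversible_dual_burnside])
  show "\<forall>A\<in>fixing_classes G E \<phi>. 0 \<le> lumped_law (dual_burnside_law G E \<phi>) A"
    by (simp add: lumped_law_def dual_burnside_law_def sum_nonneg)
  show "(\<Sum>A\<in>fixing_classes G E \<phi>. lumped_law (dual_burnside_law G E \<phi>) A) = 1"
    using sum_partition_on[OF strongly_lumpable_partition(1,2)[OF L], where f = "dual_burnside_law G E \<phi>"]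
      sum_dual_burnside_law[OF assms]
    by (simp add: lumped_law_def)
qed

lemma mixing_dist_dual_burnside_eq:
  assumes g: "g \<in> fixing_elements G E \<phi>" and t: "t \<ge> 1"
    and inv: "\<And>a h. a \<in> carrier G \<Longrightarrow> h \<in> fixing_elements G E \<phi> \<Longrightarrow>
      dual_burnside G E \<phi> g (a \<otimes> h \<otimes> inv a) = dual_burnside G E \<phi> g h"
  shows "mixing_dist (fixing_elements G E \<phi>) (dual_burnside G E \<phi>) (dual_burnside_law G E \<phi>) g t
    = mixing_dist (fixing_classes G E \<phi>) (lumped_kernel (dual_burnside G E \<phi>))
        (lumped_law (dual_burnside_law G E \<phi>)) (conj_class G g) t"
proof (rule mixing_dist_lumped_eq[OF strongly_lumpable_dual_burnside
      conj_class_fixing(2)[OF g] conj_class_fixing(1)[OF g]])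
  let ?K = "kernel_pow (fixing_elements G E \<phi>) (dual_burnside G E \<phi>) t g"
  fix B y z assume B: "B \<in> fixing_classes G E \<phi>" "y \<in> B" "z \<in> B"
  then obtain h where h: "h \<in> fixing_elements G E \<phi>" "B = conj_class G h"
    by (auto simp: fixing_classes_def)
  \<comment> \<open>Positivity of \<open>t\<close> enters here, to match the successor form of the
    symmetry lemma.\<close>
  obtain s where s: "t = Suc s" using t by (cases t) auto
  \<comment> \<open>Every member is compared with the representative \<open>h\<close>, since
    membership in the class supplies a conjugator from \<open>h\<close>.\<close>
  have "?K w = ?K h" if w: "w \<in> B" for w
  proof -
    obtain a where a: "a \<in> carrier G" "w = a \<otimes> h \<otimes> inv a"
      using w unfolding h(2) conj_class_def by blast
    have "dual_burnside G E \<phi> (a \<otimes> u \<otimes> inv a) (a \<otimes> v \<otimes> inv a) = dual_burnside G E \<phi> u v"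
      if "u \<in> fixing_elements G E \<phi>" "v \<in> fixing_elements G E \<phi>" for u v
      using dual_burnside_conj[OF a(1)] that fixing_elements_subset by blast
    from kernel_pow_Suc_symmetric[where f = "\<lambda>u. a \<otimes> u \<otimes> inv a" and P = "dual_burnside G E \<phi>",
        OF bij_betw_conj_fixing_elements[OF a(1)] this inv[OF a(1)] finite_fixing_elements g h(1)]
    show ?thesis
      unfolding s a(2) .
  qed
  thus "?K y = ?K z \<and> dual_burnside_law G E \<phi> y = dual_burnside_law G E \<phi> z"
    using B h dual_burnside_law_class[OF h(1)] by simp
qed

text \<open>Conjugation fixes a central \<open>g\<close>, so the simultaneous symmetry of the kernel
  becomes invariance in the second argument alone.\<close>

lemma dual_burnside_center:
  assumes g: "g \<in> group_center G" and a: "a \<in> carrier G" and h: "h \<in> carrier G"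
  shows "dual_burnside G E \<phi> g (a \<otimes> h \<otimes> inv a) = dual_burnside G E \<phi> g h"
proof -
  have "g \<in> carrier G" "a \<otimes> g = g \<otimes> a" using g a by (auto simp: group_center_def)
  hence "a \<otimes> g \<otimes> inv a = g" using a by (simp add: m_assoc)
  thus ?thesis using dual_burnside_conj[OF a \<open>g \<in> carrier G\<close> h] by simp
qed

end

theorem corollary3p32:
  fixes G :: "('a, 'm) monoid_scheme"
    and X :: "'x set"
    and \<phi> :: "'a \<Rightarrow> 'x \<Rightarrow> 'x"
  assumes "group_action G X \<phi>"
    and "finite (carrier G)"
    and "finite X"
    and "X \<noteq> {}"
  defines "Gs \<equiv> fixing_elements G X \<phi>"
    and "Q \<equiv> dual_burnside G X \<phi>"
    and "\<pi> \<equiv> dual_burnside_law G X \<phi>"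
    and "C \<equiv> fixing_classes G X \<phi>"
    and "Qbar \<equiv> lumped_kernel (dual_burnside G X \<phi>)"
    and "\<pi>bar \<equiv> lumped_law (dual_burnside_law G X \<phi>)"
  shows "strongly_lumpable Gs Q C \<and>
    (\<forall>g\<in>Gs. \<forall>h\<in>Gs.
       Qbar (conj_class G g) (conj_class G h) =
         1 / real (card (invariants X \<phi> g)) *
         (\<Sum>x\<in>invariants X \<phi> g.
            real (card (stabilizer G \<phi> x \<inter> conj_class G h)) / real (card (stabilizer G \<phi> x)))) \<and>
    stationary_law C Qbar \<pi>bar \<and>
    (\<forall>g\<in>Gs.
       \<pi>bar (conj_class G g) =
         real (card (conj_class G g)) * real (card (invariants X \<phi> g)) /
         (real (order G) * real (card (orbits G X \<phi>)))) \<and>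
    reversible_kernel C Qbar \<pi>bar \<and>
    irreducible_kernel C Qbar \<and>
    (\<forall>g\<in>Gs. \<forall>t.
       mixing_dist Gs Q \<pi> g t \<ge> mixing_dist C Qbar \<pi>bar (conj_class G g) t) \<and>
    (\<forall>g\<in>Gs.
       (\<forall>a\<in>carrier G. \<forall>h\<in>Gs. Q g (a \<otimes>\<^bsub>G\<^esub> h \<otimes>\<^bsub>G\<^esub> inv\<^bsub>G\<^esub> a) = Q g h) \<longrightarrow>
       (\<forall>t\<ge>1. mixing_dist Gs Q \<pi> g t = mixing_dist C Qbar \<pi>bar (conj_class G g) t)) \<and>
    (\<forall>g\<in>Gs \<inter> group_center G.
       (\<forall>a\<in>carrier G. \<forall>h\<in>Gs. Q g (a \<otimes>\<^bsub>G\<^esub> h \<otimes>\<^bsub>G\<^esub> inv\<^bsub>G\<^esub> a) = Q g h) \<and>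
       (\<forall>t\<ge>1. mixing_dist Gs Q \<pi> g t = mixing_dist C Qbar \<pi>bar (conj_class G g) t))"
proof -
  interpret finite_group_action G X \<phi>
    using assms(1-3) by (simp add: finite_group_action_def finite_group_action_axioms_def)
  note L = strongly_lumpable_dual_burnside
  have center: "dual_burnside G X \<phi> g (a \<otimes>\<^bsub>G\<^esub> h \<otimes>\<^bsub>G\<^esub> inv\<^bsub>G\<^esub> a) = dual_burnside G X \<phi> g h"
    if "g \<in> group_center G" "a \<in> carrier G" "h \<in> fixing_elements G X \<phi>" for g a h
    using dual_burnside_center that fixing_elements_subset by blast
  have "strongly_lumpable Gs Q C"
    unfolding Gs_def Q_def C_def by (rule L)
  moreover have "Qbar (conj_class G g) (conj_class G h) =
      1 / real (card (invariants X \<phi> g)) *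
      (\<Sum>x\<in>invariants X \<phi> g.
        real (card (stabilizer G \<phi> x \<inter> conj_class G h)) / real (card (stabilizer G \<phi> x)))"
    if "g \<in> Gs" "h \<in> Gs" for g h
    using that unfolding Qbar_def Gs_def by (rule lumped_dual_burnside)
  moreover have "stationary_law C Qbar \<pi>bar"
    unfolding C_def Qbar_def \<pi>bar_def by (rule stationary_lumped_dual_burnside[OF assms(4)])
  moreover have "\<pi>bar (conj_class G g) = real (card (conj_class G g)) * real (card (invariants X \<phi> g)) /
      (real (order G) * real (card (orbits G X \<phi>)))" if "g \<in> Gs" for g
    using that unfolding Gs_def \<pi>bar_def by (rule lumped_dual_burnside_law)
  moreover have "reversible_kernel C Qbar \<pi>bar"
    unfolding C_def Qbar_def \<pi>bar_def
    by (rule reversible_lumped_kernel[OF L reversible_dual_burnside])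
  moreover have "irreducible_kernel C Qbar"
    unfolding C_def Qbar_def
    by (rule irreducible_lumped_kernel[OF L irreducible_dual_burnside[OF assms(4)]])
  moreover have "mixing_dist C Qbar \<pi>bar (conj_class G g) t \<le> mixing_dist Gs Q \<pi> g t"
    if "g \<in> Gs" for g t
    using that unfolding Gs_def Q_def \<pi>_def C_def Qbar_def \<pi>bar_def
    by (intro mixing_dist_lumped_le[OF L] conj_class_fixing)
  moreover have "mixing_dist Gs Q \<pi> g t = mixing_dist C Qbar \<pi>bar (conj_class G g) t"
    if "g \<in> Gs" "\<forall>a\<in>carrier G. \<forall>h\<in>Gs. Q g (a \<otimes>\<^bsub>G\<^esub> h \<otimes>\<^bsub>G\<^esub> inv\<^bsub>G\<^esub> a) = Q g h" "t \<ge> 1" for g t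
    using that unfolding Gs_def Q_def \<pi>_def C_def Qbar_def \<pi>bar_def
    by (intro mixing_dist_dual_burnside_eq) blast+
  \<comment> \<open>Central elements thus meet the hypothesis of the preceding equality, which
    yields their case as well.\<close>
  moreover have "\<forall>a\<in>carrier G. \<forall>h\<in>Gs. Q g (a \<otimes>\<^bsub>G\<^esub> h \<otimes>\<^bsub>G\<^esub> inv\<^bsub>G\<^esub> a) = Q g h"
    if "g \<in> Gs \<inter> group_center G" for g
    using that center unfolding Gs_def Q_def by blast
  ultimately show ?thesis by (intro conjI ballI allI impI) blast+
qed

end
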